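(* Let $k\ge 1$ and let $\Upsilon$ be a subset of $\mathcal{F}_{2,k}$. Then $$\sum_{n\ge 1}\frac{t^{2n-1}}{(k(2n-1))!}\sum_{F\in\mathcal{F}^{(2),\Upsilon}_{2n-1,k}}x^{\Upsilon\text{-mch}^{(2)}(F)}=\frac{\sum_{n\ge 1}\frac{(x-1)^{n-1}t^{2n-1}}{(k(2n-1))!}\,full^{\Upsilon}_{2n-1}}{1-\sum_{n\ge 1}\frac{(x-1)^{n-1}t^{2n}}{(2kn)!}\,full^{\Upsilon}_{2n}}.$$
   Context: $\mathcal{F}_{n,k}$ is the set of all fillings $F$ of the $k\times n$ rectangular array ($k$ rows, $n$ columns) with the integers $1,\dots,kn$, each used once, such that the elements in each column increase from bottom to top. For a filling of a $k\times n$ array by distinct positive integers with columns increasing from bottom to top, $\mathrm{red}(F)\in\mathcal{F}_{n,k}$ is obtained by replacing the $i$-th smallest entry by $i$. $F[i,i+1]$ is the $k\times 2$ filling formed by columns $i$ and $i+1$ of $F$. For $\Upsilon\subseteq\mathcal{F}_{2,k}$, $F\in\mathcal{F}_{n,k}$ has an $\Upsilon$-match starting at position $i$ ($1\le i\le n-1$) if $\mathrm{red}(F[i,i+1])\in\Upsilon$; $S^{\Upsilon}(F)$ is the set of all such $i$. $\mathcal{F}^{(2),\Upsilon}_{n,k}$ is the set of $F\in\mathcal{F}_{n,k}$ such that every odd $i$ with $1\le i\le n-1$ belongs to $S^{\Upsilon}(F)$. $\Upsilon\text{-mch}^{(2)}(F)$ is the number of $i$ such that $2i\in S^{\Upsilon}(F)$.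 $full^{\Upsilon}_n$ is the number of $F\in\mathcal{F}_{n,k}$ with $\Upsilon$-matches starting at every position $1,\dots,n-1$, with $full^{\Upsilon}_1=1$ by convention. The identity is one of formal power series in $t$ with coefficients in $\mathbb{Q}[x]$. *)

theory Defs
  imports "HOL-Analysis.Analysis"
begin

text \<open>
  A filling \<open>F\<close> maps a cell \<open>(r, c)\<close>, where row \<open>r\<close> is counted from the bottom and column \<open>c\<close>
  from the left, both starting with 1, to its entry.  Fillings are extensional
  (\<open>undefined\<close> outside the array), so that distinct functions are distinct fillings.
\<close>

definition cells :: "nat \<Rightarrow> nat \<Rightarrow> (nat \<times> nat) set" where
  "cells n k = {1..k} \<times> {1..n}"

definition fillings :: "nat \<Rightarrow> nat \<Rightarrow> (nat \<times> nat \<Rightarrow> nat) set" where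
  "fillings n k =
     {F \<in> extensional (cells n k).
        bij_betw F (cells n k) {1..k * n} \<and>
        (\<forall>c\<in>{1..n}. strict_mono_on {1..k} (\<lambda>r. F (r, c)))}"

text \<open>For pairwise distinct entries, the \<open>i\<close>-th smallest entry is the one of rank \<open>i\<close>.\<close>

definition red :: "nat \<Rightarrow> nat \<Rightarrow> (nat \<times> nat \<Rightarrow> nat) \<Rightarrow> nat \<times> nat \<Rightarrow> nat" where
  "red n k F = (\<lambda>p\<in>cells n k. card {q \<in> cells n k. F q \<le> F p})"

definition two_columns :: "nat \<Rightarrow> (nat \<times> nat \<Rightarrow> nat) \<Rightarrow> nat \<Rightarrow> nat \<times> nat \<Rightarrow> nat" where
  "two_columns k F i =
     (\<lambda>(r, c)\<in>cells 2 k. if c = 1 then F (r, i) else F (r, i + 1))"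

definition match_set ::
    "(nat \<times> nat \<Rightarrow> nat) set \<Rightarrow> nat \<Rightarrow> nat \<Rightarrow> (nat \<times> nat \<Rightarrow> nat) \<Rightarrow> nat set" where
  "match_set \<Upsilon> n k F = {i. 1 \<le> i \<and> i \<le> n - 1 \<and> red 2 k (two_columns k F i) \<in> \<Upsilon>}"

definition fillings2 ::
    "(nat \<times> nat \<Rightarrow> nat) set \<Rightarrow> nat \<Rightarrow> nat \<Rightarrow> (nat \<times> nat \<Rightarrow> nat) set" where
  "fillings2 \<Upsilon> n k =
     {F \<in> fillings n k. \<forall>i. odd i \<and> 1 \<le> i \<and> i \<le> n - 1 \<longrightarrow> i \<in> match_set \<Upsilon> n k F}"

definition mch2 ::
    "(nat \<times> nat \<Rightarrow> nat) set \<Rightarrow> nat \<Rightarrow> nat \<Rightarrow> (nat \<times> nat \<Rightarrow> nat) \<Rightarrow> nat" where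
  "mch2 \<Upsilon> n k F = card {i. 2 * i \<in> match_set \<Upsilon> n k F}"

definition full :: "(nat \<times> nat \<Rightarrow> nat) set \<Rightarrow> nat \<Rightarrow> nat \<Rightarrow> nat" where
  "full \<Upsilon> n k =
     (if n = 1 then 1
      else card {F \<in> fillings n k. \<forall>i\<in>{1..n - 1}. i \<in> match_set \<Upsilon> n k F})"

text \<open>Series live in \<open>\<rat>[x][[t]]\<close>: \<open>x\<close> is the polynomial below and \<open>t\<close> is \<open>fps_X\<close>.\<close>

abbreviation x_poly :: "rat poly" where
  "x_poly \<equiv> [:0, 1:]"

text \<open>
  Division of power series in the library needs inverses of coefficients, which \<open>\<rat>[x]\<close> lacks;
  the quotient by a series with constant coefficient 1 is nevertheless defined over any
  commutative ring.
\<close>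

definition fps_quot :: "'a::comm_ring_1 fps \<Rightarrow> 'a fps \<Rightarrow> 'a fps" where
  "fps_quot f g = f * fps_right_inverse g 1"

lemma fps_quot_eq_iff:
  assumes "fps_nth g 0 = 1"
  shows "fps_quot f g = h \<longleftrightarrow> h * g = f"
proof -
  have *: "g * fps_right_inverse g 1 = 1"
    using assms by (intro fps_right_inverse) simp
  show ?thesis
  proof
    assume "fps_quot f g = h"
    then have "h * g = f * (g * fps_right_inverse g 1)"
      unfolding fps_quot_def by (metis mult.assoc mult.commute)
    with * show "h * g = f" by simp
  next
    assume "h * g = f"
    then have "fps_quot f g = h * (g * fps_right_inverse g 1)"
      unfolding fps_quot_def by (metis mult.assoc)
    with * show "fps_quot f g = h" by simp
  qed
qed

lemma has_sum_fps_monomials: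
  fixes a :: "nat \<Rightarrow> 'a::comm_ring_1"
  assumes "inj_on e A"
  shows "((\<lambda>n. fps_const (a n) * fps_X ^ e n) has_sum
           Abs_fps (\<lambda>m. \<Sum>n | n \<in> A \<and> e n = m. a n)) A"
proof (rule has_sum_fpsI)
  fix m
  have nth: "fps_nth (fps_const (a n) * fps_X ^ e n) m = (if e n = m then a n else 0)" for n
    by simp
  have fin: "finite {n \<in> A. e n = m}"
  proof -
    have "{n \<in> A. e n = m} = e -` {m} \<inter> A" by auto
    then show ?thesis using finite_vimage_IntI[of "{m}" e A] assms by simp
  qed
  show "finite {n \<in> A. fps_nth (fps_const (a n) * fps_X ^ e n) m \<noteq> 0}"
    by (rule finite_subset[OF _ fin]) (auto simp: nth split: if_splits)
  show "fps_nth (Abs_fps (\<lambda>m. \<Sum>n | n \<in> A \<and> e n = m. a n)) m =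
      (\<Sum>n | n \<in> A \<and> fps_nth (fps_const (a n) * fps_X ^ e n) m \<noteq> 0.
         fps_nth (fps_const (a n) * fps_X ^ e n) m)"
    unfolding nth fps_nth_Abs_fps
    by (rule sum.mono_neutral_cong_right) (use fin in \<open>auto split: if_splits\<close>)
qed

lemma infsum_fps_monomials_nth:
  fixes a :: "nat \<Rightarrow> 'a::comm_ring_1"
  assumes "inj_on e A"
  shows "fps_nth (\<Sum>\<^sub>\<infinity>n\<in>A. fps_const (a n) * fps_X ^ e n) m =
           (\<Sum>n | n \<in> A \<and> e n = m. a n)"
  using infsumI[OF has_sum_fps_monomials[OF assms, of a]] by simp

end

theory Submission
  imports Defs
begin

text \<open>
  Put \<open>y = x - 1\<close>.  In a filling with \<open>2 * m + 1\<close> columns whose odd positions are all matches,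
  each even position contributes a factor \<open>1 + y\<close> if it is a match and \<open>1\<close> if it is not.
  Multiplying out from the left and stopping at the first even position \<open>2 * j + 2\<close> at which
  the term \<open>1\<close> is chosen gives \<open>y ^ j\<close> times the weight of the columns after \<open>2 * j + 2\<close>, and
  only fillings that match at every position up to \<open>2 * j + 1\<close> contribute; if the term \<open>1\<close> is
  never chosen, the filling matches everywhere and contributes \<open>y ^ m\<close>.  This is
  \<open>weight_expand\<close>.

  Matches depend only on the relative order of the entries.  So for the summand with index \<open>j\<close>
  the first \<open>2 * j + 2\<close> columns and the remaining ones may be reduced separately, and a filling
  is determined by the set of entries to the left of the cut together with the two reduced parts,
  which are arbitrary (\<open>bij_betw_split_filling\<close>).  The sum over fillings thus becomes a
  binomial coefficient times a product of two sums (\<open>sum_fillings_split\<close>).  The recurrence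
  \<open>sum_weight_recurrence\<close> that results, divided by \<open>(k * (2 * m + 1))!\<close>, turns binomial
  coefficients into quotients of factorials and states the coefficient of \<open>t ^ (2 * m + 1)\<close> in
  \<open>H * (1 - D) = N\<close>, where \<open>H\<close> is the generating function in question and \<open>N\<close>, \<open>1 - D\<close>
  are the numerator and the denominator of the claimed quotient.
\<close>

section \<open>Ranks and reduction\<close>

text \<open>The rank of \<open>x\<close> among the elements of \<open>S\<close>, counted from 1.\<close>

definition rank_in :: "nat set \<Rightarrow> nat \<Rightarrow> nat" where
  "rank_in S x = card {y \<in> S. y \<le> x}"

lemma strict_mono_on_rank:
  assumes "finite S"
  shows "strict_mono_on S (rank_in S)"
proof (rule strict_mono_onI)
  fix x y assume "x \<in> S" "y \<in> S" "x < y"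
  then have "{z \<in> S. z \<le> x} \<subseteq> {z \<in> S. z \<le> y}" "y \<in> {z \<in> S. z \<le> y} - {z \<in> S. z \<le> x}"
    by auto
  then have "{z \<in> S. z \<le> x} \<subset> {z \<in> S. z \<le> y}" by blast
  then show "rank_in S x < rank_in S y"
    unfolding rank_in_def using assms by (intro psubset_card_mono) auto
qed

lemma bij_betw_rank:
  assumes "finite S"
  shows "bij_betw (rank_in S) S {1..card S}"
proof -
  have inj: "inj_on (rank_in S) S"
    using strict_mono_on_rank[OF assms] by (rule strict_mono_on_imp_inj_on)
  have "rank_in S x \<in> {1..card S}" if "x \<in> S" for x
  proof -
    have "{y \<in> S. y \<le> x} \<noteq> {}" using that by auto
    then have "rank_in S x \<noteq> 0" unfolding rank_in_def using assms by simp
    moreover have "rank_in S x \<le> card S"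
      unfolding rank_in_def using assms by (intro card_mono) auto
    ultimately show ?thesis by simp
  qed
  then have "rank_in S ` S \<subseteq> {1..card S}" by auto
  moreover have "card (rank_in S ` S) = card {1..card S}" using inj by (simp add: card_image)
  ultimately have "rank_in S ` S = {1..card S}" by (intro card_subset_eq) auto
  with inj show ?thesis by (simp add: bij_betw_def)
qed

text \<open>The element of rank \<open>i\<close> in \<open>S\<close>; meaningful for \<open>1 \<le> i \<le> card S\<close> and finite \<open>S\<close>.\<close>

definition unrank :: "nat set \<Rightarrow> nat \<Rightarrow> nat" where
  "unrank S = inv_into S (rank_in S)"

lemma bij_betw_unrank: "finite S \<Longrightarrow> bij_betw (unrank S) {1..card S} S"
  unfolding unrank_def by (intro bij_betw_inv_into bij_betw_rank)

lemma rank_unrank: "finite S \<Longrightarrow> i \<in> {1..card S} \<Longrightarrow> rank_in S (unrank S i) = i"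
  unfolding unrank_def using bij_betw_rank[of S] by (simp add: bij_betw_inv_into_right)

lemma strict_mono_on_unrank:
  assumes "finite S"
  shows "strict_mono_on {1..card S} (unrank S)"
proof (rule strict_mono_onI)
  fix i j assume ij: "i \<in> {1..card S}" "j \<in> {1..card S}" "i < j"
  have mem: "unrank S i \<in> S" "unrank S j \<in> S"
    using ij bij_betw_apply[OF bij_betw_unrank[OF assms]] by auto
  show "unrank S i < unrank S j"
  proof (rule ccontr)
    assume "\<not> ?thesis"
    then have "rank_in S (unrank S j) \<le> rank_in S (unrank S i)"
      unfolding rank_in_def using assms by (intro card_mono) auto
    then show False using ij assms by (simp add: rank_unrank)
  qed
qed

lemma finite_cells [simp]: "finite (cells n k)"
  and card_cells [simp]: "card (cells n k) = k * n"
  by (auto simp: cells_def)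

lemma red_eq_rank:
  assumes "inj_on F (cells n k)" "p \<in> cells n k"
  shows "red n k F p = rank_in (F ` cells n k) (F p)"
proof -
  have "{y \<in> F ` cells n k. y \<le> F p} = F ` {q \<in> cells n k. F q \<le> F p}" by auto
  moreover have "inj_on F {q \<in> cells n k. F q \<le> F p}"
    using assms(1) by (rule inj_on_subset) auto
  ultimately show ?thesis using assms(2) by (simp add: red_def rank_in_def card_image)
qed

text \<open>
  Reduction sees only the relative order of the entries, and (\<open>red_le_iff\<close> below) preserves it.
\<close>

lemma red_cong_order:
  assumes "\<And>p q. p \<in> cells n k \<Longrightarrow> q \<in> cells n k \<Longrightarrow> F p \<le> F q \<longleftrightarrow> G p \<le> G q"
  shows "red n k F = red n k G"
  unfolding red_def using assms by (intro restrict_ext arg_cong[of _ _ card]) auto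

lemma red_le_iff:
  assumes "inj_on F (cells n k)" "p \<in> cells n k" "q \<in> cells n k"
  shows "red n k F p \<le> red n k F q \<longleftrightarrow> F p \<le> F q"
  using assms strict_mono_on_rank[of "F ` cells n k"]
  by (simp add: red_eq_rank strict_mono_on_less_eq)

lemma fillingsD:
  assumes "F \<in> fillings n k"
  shows "F \<in> extensional (cells n k)" "bij_betw F (cells n k) {1..k * n}"
    "\<And>c. c \<in> {1..n} \<Longrightarrow> strict_mono_on {1..k} (\<lambda>r. F (r, c))"
  using assms by (auto simp: fillings_def)

lemma finite_fillings [simp]: "finite (fillings n k)"
proof (rule finite_subset)
  show "fillings n k \<subseteq> cells n k \<rightarrow>\<^sub>E {1..k * n}"
    by (auto simp: fillings_def PiE_def bij_betw_def)
qed (auto intro: finite_PiE)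

lemma red_in_fillings:
  assumes inj: "inj_on F (cells n k)"
    and mono: "\<And>c. c \<in> {1..n} \<Longrightarrow> strict_mono_on {1..k} (\<lambda>r. F (r, c))"
  shows "red n k F \<in> fillings n k"
proof -
  have "bij_betw (rank_in (F ` cells n k) \<circ> F) (cells n k) {1..card (F ` cells n k)}"
    using inj bij_betw_rank[of "F ` cells n k"]
    by (intro bij_betw_trans[of F _ "F ` cells n k"]) (auto simp: inj_on_imp_bij_betw)
  then have "bij_betw (red n k F) (cells n k) {1..k * n}"
    using inj by (subst bij_betw_cong[of _ _ "rank_in (F ` cells n k) \<circ> F"])
      (auto simp: red_eq_rank card_image)
  moreover have "strict_mono_on {1..k} (\<lambda>r. red n k F (r, c))" if c: "c \<in> {1..n}" for c
  proof (rule strict_mono_onI)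
    fix r s assume rs: "r \<in> {1..k}" "s \<in> {1..k}" "r < s"
    have "(r, c) \<in> cells n k" "(s, c) \<in> cells n k" using rs c by (auto simp: cells_def)
    moreover have "F (r, c) < F (s, c)" using strict_mono_onD[OF mono[OF c] rs] .
    ultimately show "red n k F (r, c) < red n k F (s, c)"
      using red_le_iff[OF inj, of "(s, c)" "(r, c)"] by (simp add: not_le[symmetric])
  qed
  ultimately show ?thesis unfolding fillings_def by (auto simp: red_def)
qed

lemma red_filling:
  assumes "F \<in> fillings n k"
  shows "red n k F = F"
proof
  fix p
  note F = fillingsD[OF assms]
  show "red n k F p = F p"
  proof (cases "p \<in> cells n k")
    case True
    have "F ` cells n k = {1..k * n}" "F p \<in> {1..k * n}"
      using F(2) True by (auto simp: bij_betw_def)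
    moreover from this have "{y \<in> {1..k * n}. y \<le> F p} = {1..F p}" by auto
    ultimately show ?thesis
      using True F(2) by (simp add: red_eq_rank bij_betw_def rank_in_def)
  next
    case False
    then show ?thesis using extensional_arb[OF F(1)] by (simp add: red_def)
  qed
qed

text \<open>
  This reconciles the convention \<open>full \<Upsilon> 1 k = 1\<close> with the count of fillings that it replaces.
\<close>

lemma card_fillings_one_column: "card (fillings 1 k) = 1"
proof -
  define E where "E = (\<lambda>(r, c)\<in>cells 1 k. r :: nat)"
  have E: "inj_on E (cells 1 k)"
    by (auto simp: E_def cells_def inj_on_def)
  have "red 1 k E \<in> fillings 1 k"
    by (intro red_in_fillings E) (auto simp: E_def cells_def strict_mono_on_def)
  moreover have "F = red 1 k E" if "F \<in> fillings 1 k" for F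
  proof -
    have mono: "strict_mono_on {1..k} (\<lambda>r. F (r, 1))" using fillingsD(3)[OF that] by simp
    have "red 1 k F = red 1 k E"
    proof (rule red_cong_order)
      fix p q assume "p \<in> cells 1 k" "q \<in> cells 1 k"
      then obtain r s where "p = (r, 1)" "q = (s, 1)" "r \<in> {1..k}" "s \<in> {1..k}"
        by (auto simp: cells_def)
      then show "F p \<le> F q \<longleftrightarrow> E p \<le> E q"
        using strict_mono_on_less_eq[OF mono, of r s] by (simp add: E_def cells_def)
    qed
    then show ?thesis using red_filling[OF that] by simp
  qed
  ultimately have "fillings 1 k = {red 1 k E}" by blast
  then show ?thesis by simp
qed

section \<open>Splitting a filling between two columns\<close>

text \<open>The filling seen after the first \<open>a\<close> columns have been dropped.\<close>

definition shift_columns :: "nat \<Rightarrow> (nat \<times> nat \<Rightarrow> nat) \<Rightarrow> nat \<times> nat \<Rightarrow> nat" where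
  "shift_columns a F = (\<lambda>(r, c). F (r, c + a))"

text \<open>The cells of a \<open>k \<times> (a + b)\<close> array to the right of column \<open>a\<close>.\<close>

definition right_cells :: "nat \<Rightarrow> nat \<Rightarrow> nat \<Rightarrow> (nat \<times> nat) set" where
  "right_cells a b k = {1..k} \<times> {a + 1..a + b}"

lemma cells_add: "cells (a + b) k = cells a k \<union> right_cells a b k"
  and cells_disjoint: "cells a k \<inter> right_cells a b k = {}"
  by (auto simp: cells_def right_cells_def)

lemma bij_betw_shift: "bij_betw (\<lambda>(r, c). (r, c + a)) (cells b k) (right_cells a b k)"
  by (rule bij_betw_byWitness[where f' = "\<lambda>(r, c). (r, c - a)"])
    (auto simp: cells_def right_cells_def)

lemma shift_columns_comp: "shift_columns a F = F \<circ> (\<lambda>(r, c). (r, c + a))"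
  by (auto simp: shift_columns_def)

lemma image_shift_columns: "shift_columns a F ` cells b k = F ` right_cells a b k"
  unfolding shift_columns_comp image_comp[symmetric]
  by (simp only: bij_betw_imp_surj_on[OF bij_betw_shift])

context
  fixes F :: "nat \<times> nat \<Rightarrow> nat" and a b k :: nat
  assumes F: "F \<in> fillings (a + b) k"
begin

lemma inj_left: "inj_on F (cells a k)"
  using fillingsD(2)[OF F] by (auto simp: bij_betw_def cells_add inj_on_Un)

lemma inj_right: "inj_on (shift_columns a F) (cells b k)"
  unfolding shift_columns_comp using fillingsD(2)[OF F] bij_betw_shift[of a b k]
  by (intro comp_inj_on) (auto simp: bij_betw_def cells_add inj_on_Un)

lemma red_left_in_fillings: "red a k F \<in> fillings a k"
  using fillingsD(3)[OF F] by (intro red_in_fillings inj_left) auto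

lemma red_right_in_fillings: "red b k (shift_columns a F) \<in> fillings b k"
  using fillingsD(3)[OF F] by (intro red_in_fillings inj_right) (auto simp: shift_columns_def)

lemma image_right: "F ` right_cells a b k = {1..k * (a + b)} - F ` cells a k"
proof -
  have "inj_on F (cells a k \<union> right_cells a b k)"
    "F ` (cells a k \<union> right_cells a b k) = {1..k * (a + b)}"
    using fillingsD(2)[OF F] by (auto simp: bij_betw_def cells_add)
  then show ?thesis
    using cells_disjoint[of a k b] by (auto simp: inj_on_def)
qed

end

text \<open>
  A filling of \<open>a + b\<close> columns is cut after column \<open>a\<close> and encoded by the set of entries on the
  left and the reductions of the two parts.  No restriction to the first \<open>a\<close> columns is
  needed on the left, since \<open>red a k\<close> only inspects the cells of these columns.
\<close>

definition split_filling ::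
    "nat \<Rightarrow> nat \<Rightarrow> nat \<Rightarrow> (nat \<times> nat \<Rightarrow> nat) \<Rightarrow>
      nat set \<times> (nat \<times> nat \<Rightarrow> nat) \<times> (nat \<times> nat \<Rightarrow> nat)" where
  "split_filling a b k F = (F ` cells a k, red a k F, red b k (shift_columns a F))"

lemma inj_on_split_filling: "inj_on (split_filling a b k) (fillings (a + b) k)"
proof (rule inj_onI)
  fix F G assume F: "F \<in> fillings (a + b) k" and G: "G \<in> fillings (a + b) k"
    and eq: "split_filling a b k F = split_filling a b k G"
  define S where "S = F ` cells a k"
  define T where "T = F ` right_cells a b k"
  have SG: "G ` cells a k = S" using eq by (simp add: split_filling_def S_def)
  then have TG: "G ` right_cells a b k = T"
    using image_right[OF F] image_right[OF G] by (simp add: S_def T_def)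
  have fin: "finite S" "finite T" by (auto simp: S_def T_def right_cells_def)
  have left: "F p = G p" if p: "p \<in> cells a k" for p
  proof -
    have "rank_in S (F p) = rank_in S (G p)"
      using eq p red_eq_rank[OF inj_left[OF F] p] red_eq_rank[OF inj_left[OF G] p] SG
      by (simp add: split_filling_def S_def)
    moreover have "F p \<in> S" "G p \<in> S" using p SG by (auto simp: S_def)
    ultimately show ?thesis
      using bij_betw_rank[OF fin(1)] by (auto simp: bij_betw_def inj_on_def)
  qed
  have right: "F p = G p" if p: "p \<in> right_cells a b k" for p
  proof -
    obtain q where q: "q \<in> cells b k" and pq: "p = (\<lambda>(r, c). (r, c + a)) q"
      using p unfolding bij_betw_imp_surj_on[OF bij_betw_shift[of a b k], symmetric]
      by (rule imageE)
    have "rank_in T (shift_columns a F q) = rank_in T (shift_columns a G q)"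
      using eq q red_eq_rank[OF inj_right[OF F] q] red_eq_rank[OF inj_right[OF G] q] TG
      by (simp add: split_filling_def T_def image_shift_columns)
    then have "rank_in T (F p) = rank_in T (G p)" by (simp add: shift_columns_comp pq)
    moreover have "F p \<in> T" "G p \<in> T" using p TG by (auto simp: T_def)
    ultimately show ?thesis
      using bij_betw_rank[OF fin(2)] by (auto simp: bij_betw_def inj_on_def)
  qed
  show "F = G"
    using fillingsD(1)[OF F] fillingsD(1)[OF G]
    by (rule extensionalityI) (use left right in \<open>auto simp: cells_add\<close>)
qed

text \<open>
  To recover the filling, the left part \<open>G\<close> is relabelled by the elements of \<open>S\<close>, and the right
  part \<open>H\<close> by the remaining entries, both in increasing order.
\<close>

lemma split_filling_surj:
  assumes S: "S \<subseteq> {1..k * (a + b)}" "card S = k * a"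
    and G: "G \<in> fillings a k" and H: "H \<in> fillings b k"
  shows "\<exists>F\<in>fillings (a + b) k. split_filling a b k F = (S, G, H)"
proof -
  define T where "T = {1..k * (a + b)} - S"
  have fin: "finite S" "finite T" using S(1) finite_subset by (auto simp: T_def)
  have cardT: "card T = k * b"
    using S fin by (simp add: T_def card_Diff_subset algebra_simps)
  define F where "F = (\<lambda>(r, c)\<in>cells (a + b) k.
    if c \<le> a then unrank S (G (r, c)) else unrank T (H (r, c - a)))"
  have FL: "F p = unrank S (G p)" if "p \<in> cells a k" for p
    using that by (auto simp: F_def cells_def)
  have FR: "shift_columns a F p = unrank T (H p)" if "p \<in> cells b k" for p
    using that by (auto simp: F_def cells_def shift_columns_def)
  have bijL: "bij_betw F (cells a k) S"
    using bij_betw_trans[OF fillingsD(2)[OF G] bij_betw_unrank[OF fin(1), unfolded S(2)]]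
    by (subst bij_betw_cong[of _ _ "unrank S \<circ> G"]) (auto simp: FL)
  have bijR: "bij_betw (shift_columns a F) (cells b k) T"
    using bij_betw_trans[OF fillingsD(2)[OF H] bij_betw_unrank[OF fin(2), unfolded cardT]]
    by (subst bij_betw_cong[of _ _ "unrank T \<circ> H"]) (auto simp: FR)
  have "bij_betw F (right_cells a b k) T"
    using bijR bij_betw_shift[of a b k] bij_betw_comp_iff[of _ "cells b k" "right_cells a b k" F T]
    by (simp add: shift_columns_comp)
  then have "bij_betw F (cells (a + b) k) (S \<union> T)"
    unfolding cells_add by (rule bij_betw_combine[OF bijL]) (auto simp: T_def)
  moreover have "S \<union> T = {1..k * (a + b)}" using S(1) by (auto simp: T_def)
  moreover have "strict_mono_on {1..k} (\<lambda>r. F (r, c))" if c: "c \<in> {1..a + b}" for c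
  proof (rule strict_mono_onI)
    fix r s assume rs: "r \<in> {1..k}" "s \<in> {1..k}" "r < s"
    show "F (r, c) < F (s, c)"
    proof (cases "c \<le> a")
      case True
      then have p: "(r, c) \<in> cells a k" "(s, c) \<in> cells a k" using rs c by (auto simp: cells_def)
      have "G (r, c) < G (s, c)"
        using strict_mono_onD[OF fillingsD(3)[OF G, of c] rs] True c by simp
      moreover have "G (r, c) \<in> {1..card S}" "G (s, c) \<in> {1..card S}"
        using bij_betw_apply[OF fillingsD(2)[OF G]] p S(2) by auto
      ultimately show ?thesis
        using strict_mono_onD[OF strict_mono_on_unrank[OF fin(1)]] p by (simp add: FL)
    next
      case False
      then have p: "(r, c - a) \<in> cells b k" "(s, c - a) \<in> cells b k"
        using rs c by (auto simp: cells_def)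
      have "H (r, c - a) < H (s, c - a)"
        by (rule strict_mono_onD[OF fillingsD(3)[OF H, of "c - a"] rs]) (use False c in auto)
      moreover have "H (r, c - a) \<in> {1..card T}" "H (s, c - a) \<in> {1..card T}"
        using bij_betw_apply[OF fillingsD(2)[OF H]] p cardT by auto
      ultimately have "shift_columns a F (r, c - a) < shift_columns a F (s, c - a)"
        using strict_mono_onD[OF strict_mono_on_unrank[OF fin(2)]] p by (simp add: FR)
      then show ?thesis using False by (simp add: shift_columns_def)
    qed
  qed
  ultimately have "F \<in> fillings (a + b) k" by (simp add: fillings_def F_def)
  moreover have "F ` cells a k = S" using bijL by (simp add: bij_betw_def)
  moreover have "red a k F = G"
  proof (rule extensionalityI[of _ "cells a k"])
    fix p assume p: "p \<in> cells a k"
    then have "G p \<in> {1..card S}" using bij_betw_apply[OF fillingsD(2)[OF G]] S(2) by auto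
    then show "red a k F p = G p"
      using bijL p fin(1) by (simp add: red_eq_rank bij_betw_def FL rank_unrank)
  qed (use fillingsD(1)[OF G] in \<open>auto simp: red_def\<close>)
  moreover have "red b k (shift_columns a F) = H"
  proof (rule extensionalityI[of _ "cells b k"])
    fix p assume p: "p \<in> cells b k"
    then have "H p \<in> {1..card T}" using bij_betw_apply[OF fillingsD(2)[OF H]] cardT by auto
    then show "red b k (shift_columns a F) p = H p"
      using bijR p fin(2) by (simp add: red_eq_rank bij_betw_def FR rank_unrank)
  qed (use fillingsD(1)[OF H] in \<open>auto simp: red_def\<close>)
  ultimately show ?thesis by (auto simp: split_filling_def)
qed

lemma bij_betw_split_filling:
  "bij_betw (split_filling a b k) (fillings (a + b) k)
     ({S. S \<subseteq> {1..k * (a + b)} \<and> card S = k * a} \<times> fillings a k \<times> fillings b k)"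
  unfolding bij_betw_def
proof (intro conjI inj_on_split_filling equalityI subsetI)
  fix z assume "z \<in> split_filling a b k ` fillings (a + b) k"
  then obtain F where F: "F \<in> fillings (a + b) k" and z: "z = split_filling a b k F" by auto
  have "F ` cells a k \<subseteq> {1..k * (a + b)}"
    using fillingsD(2)[OF F] by (auto simp: bij_betw_def cells_add)
  moreover have "card (F ` cells a k) = k * a" using inj_left[OF F] by (simp add: card_image)
  ultimately show "z \<in> {S. S \<subseteq> {1..k * (a + b)} \<and> card S = k * a} \<times> fillings a k \<times> fillings b k"
    using red_left_in_fillings[OF F] red_right_in_fillings[OF F] by (simp add: z split_filling_def)
next
  fix z assume "z \<in> {S. S \<subseteq> {1..k * (a + b)} \<and> card S = k * a} \<times> fillings a k \<times> fillings b k"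
  then obtain S G H where z: "z = (S, G, H)" and "S \<subseteq> {1..k * (a + b)}" "card S = k * a"
    "G \<in> fillings a k" "H \<in> fillings b k"
    by auto
  then obtain F where "F \<in> fillings (a + b) k" "split_filling a b k F = z"
    using split_filling_surj by blast
  then show "z \<in> split_filling a b k ` fillings (a + b) k" by blast
qed

text \<open>
  The exponential product formula: weights of the two reduced parts separate, and the choice of the
  entries on the left contributes the binomial coefficient.
\<close>

lemma sum_fillings_split:
  fixes f g :: "(nat \<times> nat \<Rightarrow> nat) \<Rightarrow> 'a :: comm_semiring_1"
  shows "(\<Sum>F\<in>fillings (a + b) k. f (red a k F) * g (red b k (shift_columns a F))) =
    of_nat ((k * (a + b)) choose (k * a)) * ((\<Sum>G\<in>fillings a k. f G) * (\<Sum>H\<in>fillings b k. g H))"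
proof -
  let ?C = "{S. S \<subseteq> {1..k * (a + b)} \<and> card S = k * a}"
  have "(\<Sum>F\<in>fillings (a + b) k. f (red a k F) * g (red b k (shift_columns a F))) =
      (\<Sum>F\<in>fillings (a + b) k. (\<lambda>(S, G, H). f G * g H) (split_filling a b k F))"
    by (simp add: split_filling_def)
  also have "\<dots> = (\<Sum>(S, G, H)\<in>?C \<times> fillings a k \<times> fillings b k. f G * g H)"
    by (rule sum.reindex_bij_betw[OF bij_betw_split_filling])
  also have "\<dots> = of_nat (card ?C) * (\<Sum>G\<in>fillings a k. \<Sum>H\<in>fillings b k. f G * g H)"
    by (simp add: sum.cartesian_product[symmetric])
  also have "card ?C = (k * (a + b)) choose (k * a)"
    by (simp add: n_subsets)
  finally show ?thesis by (simp add: sum_product)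
qed

section \<open>Matches\<close>

text \<open>
  An \<open>\<Upsilon>\<close>-match at position \<open>i\<close>, without the bound on \<open>i\<close> that \<open>match_set\<close> includes.
\<close>

definition match_at :: "(nat \<times> nat \<Rightarrow> nat) set \<Rightarrow> nat \<Rightarrow> (nat \<times> nat \<Rightarrow> nat) \<Rightarrow> nat \<Rightarrow> bool" where
  "match_at \<Upsilon> k F i \<longleftrightarrow> red 2 k (two_columns k F i) \<in> \<Upsilon>"

lemma match_at_red:
  assumes inj: "inj_on F (cells n k)" and i: "1 \<le> i" "i < n"
  shows "match_at \<Upsilon> k (red n k F) i \<longleftrightarrow> match_at \<Upsilon> k F i"
proof -
  have "red 2 k (two_columns k (red n k F) i) = red 2 k (two_columns k F i)"
  proof (rule red_cong_order)
    fix p q assume "p \<in> cells 2 k" "q \<in> cells 2 k"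
    \<comment> \<open>The two-column array reads its entries from cells that do not depend on the filling.\<close>
    moreover have "\<exists>p'\<in>cells n k. \<forall>E. two_columns k E i p = E p'" if "p \<in> cells 2 k" for p
      using that i
      by (intro bexI[of _ "(fst p, if snd p = 1 then i else i + 1)"])
        (auto simp: two_columns_def cells_def)
    ultimately obtain p' q' where "p' \<in> cells n k" "q' \<in> cells n k"
      "\<And>E. two_columns k E i p = E p'" "\<And>E. two_columns k E i q = E q'"
      by meson
    then show "two_columns k (red n k F) i p \<le> two_columns k (red n k F) i q \<longleftrightarrow>
        two_columns k F i p \<le> two_columns k F i q"
      using red_le_iff[OF inj] by simp
  qed
  then show ?thesis by (simp add: match_at_def)
qed

lemma match_at_shift_columns: "match_at \<Upsilon> k (shift_columns a F) i \<longleftrightarrow> match_at \<Upsilon> k F (i + a)"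
proof -
  have "two_columns k (shift_columns a F) i = two_columns k F (i + a)"
    by (auto simp: two_columns_def shift_columns_def algebra_simps intro!: restrict_ext)
  then show ?thesis by (simp add: match_at_def)
qed

text \<open>
  The weight of a pattern \<open>M\<close> of matches at the positions \<open>1, \<dots>, 2 * m\<close> of \<open>2 * m + 1\<close> columns:
  zero unless all odd positions are matches, and otherwise \<open>x\<close> to the number of even matches
  (\<open>weight_eq_mch2\<close>).  The product form makes it peel off two positions at a time.
\<close>

definition weight :: "nat \<Rightarrow> (nat \<Rightarrow> bool) \<Rightarrow> rat poly" where
  "weight m M = (\<Prod>i<m. of_bool (M (2 * i + 1)) * (if M (2 * i + 2) then x_poly else 1))"

lemma weight_cong:
  assumes "\<And>i. 1 \<le> i \<Longrightarrow> i \<le> 2 * m \<Longrightarrow> M i = M' i"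
  shows "weight m M = weight m M'"
  unfolding weight_def using assms by (intro prod.cong) auto

lemma weight_Suc:
  "weight (Suc m) M =
    of_bool (M 1) * (if M 2 then x_poly else 1) * weight m (\<lambda>i. M (i + 2))"
  unfolding weight_def prod.lessThan_Suc_shift by (simp add: mult.assoc numeral_2_eq_2)

text \<open>
  The index \<open>j\<close> records that \<open>2 * j + 2\<close> is the first even position at which \<open>1\<close> rather than
  \<open>x - 1\<close> is chosen in the factor \<open>1 + (x - 1)\<close> of a match, or at which there is no match.
  The columns up to that position form a block of even length with matches throughout; the first
  summand is the case of a single block of odd length.
\<close>

lemma weight_expand:
  "weight m M = (x_poly - 1) ^ m * of_bool (\<forall>i\<in>{1..2 * m}. M i) +
    (\<Sum>j<m. (x_poly - 1) ^ j * (of_bool (\<forall>i\<in>{1..2 * j + 1}. M i) *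
       weight (m - Suc j) (\<lambda>i. M (i + (2 * j + 2)))))"
proof (induction m arbitrary: M)
  case 0
  show ?case by (simp add: weight_def)
next
  case (Suc m)
  let ?y = "x_poly - 1"
  have shift: "(\<forall>i\<in>{1..n + 2}. M i) \<longleftrightarrow> M 1 \<and> M 2 \<and> (\<forall>i\<in>{1..n}. M (i + 2))" for n
  proof -
    have "{1..n + 2} = {1, 2} \<union> (\<lambda>i. i + 2) ` {1..n}"
      by (auto simp: image_iff Bex_def) presburger
    then show ?thesis by auto
  qed
  have "(if M 2 then x_poly else 1) = 1 + ?y * of_bool (M 2)" by simp
  then have "weight (Suc m) M = of_bool (M 1) * weight m (\<lambda>i. M (i + 2)) +
      ?y * of_bool (M 1 \<and> M 2) * weight m (\<lambda>i. M (i + 2))"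
    unfolding weight_Suc by (simp add: algebra_simps)
  also have "?y * of_bool (M 1 \<and> M 2) * weight m (\<lambda>i. M (i + 2)) =
      ?y ^ Suc m * of_bool (\<forall>i\<in>{1..2 * m + 2}. M i) +
      (\<Sum>j<m. ?y ^ Suc j * (of_bool (\<forall>i\<in>{1..(2 * j + 1) + 2}. M i) *
       weight (m - Suc j) (\<lambda>i. M (i + (2 * j + 2) + 2))))"
    unfolding shift by (subst Suc.IH) (auto simp: algebra_simps sum_distrib_left)
  finally show ?case
    unfolding sum.lessThan_Suc_shift by (simp add: algebra_simps)
qed

lemma match_set_iff: "i \<in> match_set \<Upsilon> n k F \<longleftrightarrow> 1 \<le> i \<and> i \<le> n - 1 \<and> match_at \<Upsilon> k F i"
  by (auto simp: match_set_def match_at_def)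

lemma weight_eq_mch2:
  "weight m (match_at \<Upsilon> k F) =
    (if \<forall>i. odd i \<and> 1 \<le> i \<and> i \<le> 2 * m \<longrightarrow> match_at \<Upsilon> k F i
     then x_poly ^ mch2 \<Upsilon> (2 * m + 1) k F else 0)"
proof -
  let ?M = "match_at \<Upsilon> k F"
  have odd: "(\<forall>i. odd i \<and> 1 \<le> i \<and> i \<le> 2 * m \<longrightarrow> ?M i) \<longleftrightarrow> (\<forall>i<m. ?M (2 * i + 1))"
    by (auto elim!: oddE)
  have "{i. 2 * i \<in> match_set \<Upsilon> (2 * m + 1) k F} = Suc ` {i \<in> {..<m}. ?M (2 * i + 2)}"
    (is "?L = ?R")
  proof (intro equalityI subsetI)
    fix i assume "i \<in> ?L"
    then show "i \<in> ?R" by (cases i) (auto simp: match_set_iff image_iff)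
  qed (auto simp: match_set_iff)
  then have "mch2 \<Upsilon> (2 * m + 1) k F = card {i \<in> {..<m}. ?M (2 * i + 2)}"
    unfolding mch2_def by (simp add: card_image)
  moreover have "(\<Prod>i<m. if ?M (2 * i + 2) then x_poly else 1) =
      x_poly ^ card {i \<in> {..<m}. ?M (2 * i + 2)}"
    by (subst prod.inter_filter[symmetric]) auto
  moreover have "(\<Prod>i<m. of_bool (?M (2 * i + 1)) :: rat poly) = of_bool (\<forall>i<m. ?M (2 * i + 1))"
    by (induction m) (auto simp: less_Suc_eq)
  ultimately show ?thesis
    unfolding odd by (simp add: weight_def prod.distrib)
qed

lemma sum_fillings2:
  "(\<Sum>F\<in>fillings2 \<Upsilon> (2 * m + 1) k. x_poly ^ mch2 \<Upsilon> (2 * m + 1) k F) =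
    (\<Sum>F\<in>fillings (2 * m + 1) k. weight m (match_at \<Upsilon> k F))"
proof -
  have "fillings2 \<Upsilon> (2 * m + 1) k = {F \<in> fillings (2 * m + 1) k.
      \<forall>i. odd i \<and> 1 \<le> i \<and> i \<le> 2 * m \<longrightarrow> match_at \<Upsilon> k F i}"
    by (auto simp: fillings2_def match_set_iff)
  then show ?thesis
    unfolding weight_eq_mch2 by (simp only: sum.inter_filter[OF finite_fillings])
qed

text \<open>For \<open>n = 1\<close> the condition on the fillings is vacuous, so the formula includes the convention.\<close>

lemma of_nat_full:
  assumes "1 \<le> n"
  shows "of_nat (full \<Upsilon> n k) =
    (\<Sum>F\<in>fillings n k. of_bool (\<forall>i\<in>{1..n - 1}. match_at \<Upsilon> k F i) :: 'a :: comm_semiring_1)"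
proof (cases "n = 1")
  case True
  then show ?thesis using card_fillings_one_column[of k] by (simp add: full_def)
next
  case False
  have "{F \<in> fillings n k. \<forall>i\<in>{1..n - 1}. i \<in> match_set \<Upsilon> n k F} =
      fillings n k \<inter> {F. \<forall>i\<in>{1..n - 1}. match_at \<Upsilon> k F i}"
    by (auto simp: match_set_iff)
  then show ?thesis using False by (simp add: full_def sum_of_bool_eq)
qed

text \<open>
  Summing \<open>weight_expand\<close> over all fillings, with the \<open>j\<close>-th summand cut after column
  \<open>2 * j + 2\<close>.
\<close>

lemma sum_weight_recurrence:
  "(\<Sum>F\<in>fillings (2 * m + 1) k. weight m (match_at \<Upsilon> k F)) =
    (x_poly - 1) ^ m * of_nat (full \<Upsilon> (2 * m + 1) k) +
    (\<Sum>j<m. (x_poly - 1) ^ j * (of_nat ((k * (2 * m + 1)) choose (k * (2 * j + 2))) *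
      (of_nat (full \<Upsilon> (2 * j + 2) k) *
       (\<Sum>F\<in>fillings (2 * (m - Suc j) + 1) k. weight (m - Suc j) (match_at \<Upsilon> k F)))))"
proof -
  let ?y = "x_poly - 1" and ?M = "match_at \<Upsilon> k"
  have "(\<Sum>F\<in>fillings (2 * m + 1) k. of_bool (\<forall>i\<in>{1..2 * j + 1}. ?M F i) *
       weight (m - Suc j) (\<lambda>i. ?M F (i + (2 * j + 2)))) =
     of_nat ((k * (2 * m + 1)) choose (k * (2 * j + 2))) * (of_nat (full \<Upsilon> (2 * j + 2) k) *
       (\<Sum>F\<in>fillings (2 * (m - Suc j) + 1) k. weight (m - Suc j) (?M F)))"
    (is "?lhs = _") if j: "j < m" for j
  proof -
    let ?a = "2 * j + 2" and ?b = "2 * (m - Suc j) + 1"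
    have ab: "2 * m + 1 = ?a + ?b" using j by simp
    have "?lhs = (\<Sum>F\<in>fillings (?a + ?b) k. of_bool (\<forall>i\<in>{1..?a - 1}. ?M (red ?a k F) i) *
       weight (m - Suc j) (?M (red ?b k (shift_columns ?a F))))"
      unfolding ab
    proof (intro sum.cong refl arg_cong2[where f = "(*)"])
      fix F assume F: "F \<in> fillings (?a + ?b) k"
      show "of_bool (\<forall>i\<in>{1..2 * j + 1}. ?M F i) =
          (of_bool (\<forall>i\<in>{1..?a - 1}. ?M (red ?a k F) i) :: rat poly)"
        using match_at_red[OF inj_left[OF F]] by (intro arg_cong[of _ _ of_bool]) auto
      show "weight (m - Suc j) (\<lambda>i. ?M F (i + (2 * j + 2))) =
          weight (m - Suc j) (?M (red ?b k (shift_columns ?a F)))"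
        using match_at_red[OF inj_right[OF F]]
        by (intro weight_cong) (simp add: match_at_shift_columns)
    qed
    also have "\<dots> = of_nat ((k * (?a + ?b)) choose (k * ?a)) *
        ((\<Sum>G\<in>fillings ?a k. of_bool (\<forall>i\<in>{1..?a - 1}. ?M G i)) *
         (\<Sum>H\<in>fillings ?b k. weight (m - Suc j) (?M H)))"
      by (rule sum_fillings_split)
    finally show ?thesis unfolding ab by (subst of_nat_full) simp_all
  qed
  note block = this
  have "(\<Sum>F\<in>fillings (2 * m + 1) k. weight m (?M F)) =
    ?y ^ m * (\<Sum>F\<in>fillings (2 * m + 1) k. of_bool (\<forall>i\<in>{1..2 * m}. ?M F i)) +
    (\<Sum>j<m. ?y ^ j * (\<Sum>F\<in>fillings (2 * m + 1) k. of_bool (\<forall>i\<in>{1..2 * j + 1}. ?M F i) *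
       weight (m - Suc j) (\<lambda>i. ?M F (i + (2 * j + 2)))))"
    unfolding sum_distrib_left
    by (subst sum.swap, subst weight_expand) (simp only: sum.distrib)
  also have "(\<Sum>F\<in>fillings (2 * m + 1) k. of_bool (\<forall>i\<in>{1..2 * m}. ?M F i)) =
      (of_nat (full \<Upsilon> (2 * m + 1) k) :: rat poly)"
    by (subst of_nat_full) simp_all
  also have "(\<Sum>j<m. ?y ^ j * (\<Sum>F\<in>fillings (2 * m + 1) k.
        of_bool (\<forall>i\<in>{1..2 * j + 1}. ?M F i) *
        weight (m - Suc j) (\<lambda>i. ?M F (i + (2 * j + 2))))) =
      (\<Sum>j<m. ?y ^ j * (of_nat ((k * (2 * m + 1)) choose (k * (2 * j + 2))) *
        (of_nat (full \<Upsilon> (2 * j + 2) k) *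
         (\<Sum>F\<in>fillings (2 * (m - Suc j) + 1) k. weight (m - Suc j) (?M F)))))"
    by (intro sum.cong refl, subst block) simp_all
  finally show ?thesis .
qed

section \<open>The generating function\<close>

text \<open>
  A convolution recurrence as a product of power series.  Here \<open>h m\<close> and \<open>n m\<close> are the
  coefficients of degree \<open>2 * m + 1\<close>, and \<open>d j\<close> is that of degree \<open>2 * j + 2\<close>.
\<close>

lemma fps_odd_recurrence:
  fixes h n d :: "nat \<Rightarrow> 'a :: comm_ring_1"
  assumes "\<And>m. h m = n m + (\<Sum>j<m. d j * h (m - Suc j))"
  shows "Abs_fps (\<lambda>p. if odd p then h (p div 2) else 0) *
      (1 - Abs_fps (\<lambda>p. if even p \<and> p > 0 then d (p div 2 - 1) else 0)) =
    Abs_fps (\<lambda>p. if odd p then n (p div 2) else 0)"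
    (is "?H * (1 - ?D) = ?N")
proof -
  have "fps_nth ?H p = fps_nth (?N + ?D * ?H) p" for p
  proof (cases "odd p")
    case False
    then have "(\<Sum>i=0..p. fps_nth ?D i * fps_nth ?H (p - i)) = 0"
      by (intro sum.neutral) auto
    then show ?thesis using False by (simp add: fps_mult_nth)
  next
    case True
    then obtain m where p: "p = 2 * m + 1" by (elim oddE)
    \<comment> \<open>Only the even degrees \<open>2, 4, \<dots>, 2 * m\<close> of \<open>?D\<close> contribute.\<close>
    have "(\<Sum>i=0..p. fps_nth ?D i * fps_nth ?H (p - i)) =
        (\<Sum>i\<in>(\<lambda>j. 2 * j + 2) ` {..<m}. fps_nth ?D i * fps_nth ?H (p - i))"
    proof (rule sum.mono_neutral_right)
      show "\<forall>i\<in>{0..p} - (\<lambda>j. 2 * j + 2) ` {..<m}. fps_nth ?D i * fps_nth ?H (p - i) = 0"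
      proof
        fix i assume i: "i \<in> {0..p} - (\<lambda>j. 2 * j + 2) ` {..<m}"
        have "\<not> (even i \<and> i > 0)"
        proof
          assume "even i \<and> i > 0"
          then have "i = 2 * (i div 2 - 1) + 2" "i div 2 - 1 < m" using i p by auto
          then show False using i by blast
        qed
        then have "fps_nth ?D i = 0" by auto
        then show "fps_nth ?D i * fps_nth ?H (p - i) = 0" by simp
      qed
    qed (auto simp: p)
    also have "\<dots> = (\<Sum>j<m. d j * h (m - Suc j))"
    proof (subst sum.reindex)
      have "(2 * m + 1 - (2 * j + 2)) div 2 = m - Suc j" if "j < m" for j
        using that by presburger
      then show "(\<Sum>j<m. ((\<lambda>i. fps_nth ?D i * fps_nth ?H (p - i)) \<circ> (\<lambda>j. 2 * j + 2)) j) =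
          (\<Sum>j<m. d j * h (m - Suc j))"
        by (intro sum.cong refl) (simp add: p)
    qed (auto simp: inj_on_def)
    finally show ?thesis using assms[of m] by (simp add: p fps_mult_nth)
  qed
  then have "?H = ?N + ?D * ?H" by (rule fps_ext)
  then show ?thesis by (simp add: algebra_simps)
qed

lemma infsum_odd_monomials:
  fixes a :: "nat \<Rightarrow> 'a :: comm_ring_1"
  shows "(\<Sum>\<^sub>\<infinity>n\<in>{1..}. fps_const (a n) * fps_X ^ (2 * n - 1)) =
    Abs_fps (\<lambda>p. if odd p then a (Suc (p div 2)) else 0)"
proof (rule fps_ext)
  fix p
  have "inj_on (\<lambda>n::nat. 2 * n - 1) {1..}" by (auto simp: inj_on_def)
  moreover have "{n \<in> {1..}. 2 * n - 1 = p} = (if odd p then {Suc (p div 2)} else {})"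
    by (auto elim!: oddE)
  ultimately show "fps_nth (\<Sum>\<^sub>\<infinity>n\<in>{1..}. fps_const (a n) * fps_X ^ (2 * n - 1)) p =
      fps_nth (Abs_fps (\<lambda>p. if odd p then a (Suc (p div 2)) else 0)) p"
    by (subst infsum_fps_monomials_nth) auto
qed

lemma infsum_even_monomials:
  fixes a :: "nat \<Rightarrow> 'a :: comm_ring_1"
  shows "(\<Sum>\<^sub>\<infinity>n\<in>{1..}. fps_const (a n) * fps_X ^ (2 * n)) =
    Abs_fps (\<lambda>p. if even p \<and> p > 0 then a (Suc (p div 2 - 1)) else 0)"
proof (rule fps_ext)
  fix p
  have "inj_on (\<lambda>n::nat. 2 * n) {1..}" by (auto simp: inj_on_def)
  moreover have "{n \<in> {1..}. 2 * n = p} = (if even p \<and> p > 0 then {Suc (p div 2 - 1)} else {})"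
    by auto
  ultimately show "fps_nth (\<Sum>\<^sub>\<infinity>n\<in>{1..}. fps_const (a n) * fps_X ^ (2 * n)) p =
      fps_nth (Abs_fps (\<lambda>p. if even p \<and> p > 0 then a (Suc (p div 2 - 1)) else 0)) p"
    by (subst infsum_fps_monomials_nth) auto
qed

theorem theorem8:
  fixes k :: nat and \<Upsilon> :: "(nat \<times> nat \<Rightarrow> nat) set"
  assumes "k \<ge> 1" and "\<Upsilon> \<subseteq> fillings 2 k"
  shows
    "(\<Sum>\<^sub>\<infinity>n\<in>{1..}.
        fps_const (smult (1 / fact (k * (2 * n - 1)))
          (\<Sum>F\<in>fillings2 \<Upsilon> (2 * n - 1) k. x_poly ^ mch2 \<Upsilon> (2 * n - 1) k F))
        * fps_X ^ (2 * n - 1)) =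
     fps_quot
       (\<Sum>\<^sub>\<infinity>n\<in>{1..}.
          fps_const (smult (of_nat (full \<Upsilon> (2 * n - 1) k) / fact (k * (2 * n - 1)))
            ((x_poly - 1) ^ (n - 1)))
          * fps_X ^ (2 * n - 1))
       (1 - (\<Sum>\<^sub>\<infinity>n\<in>{1..}.
          fps_const (smult (of_nat (full \<Upsilon> (2 * n) k) / fact (2 * k * n))
            ((x_poly - 1) ^ (n - 1)))
          * fps_X ^ (2 * n)))"
proof -
  \<comment> \<open>Series indices start at 1, while \<open>m\<close> and \<open>j\<close> start at 0: \<open>n = Suc m\<close> and \<open>n = Suc j\<close>.\<close>
  define A where "A m = (\<Sum>F\<in>fillings (2 * m + 1) k. weight m (match_at \<Upsilon> k F))" for m
  define h where "h m = smult (1 / fact (k * (2 * m + 1))) (A m)" for m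
  define n where "n m = smult (of_nat (full \<Upsilon> (2 * m + 1) k) / fact (k * (2 * m + 1)))
    ((x_poly - 1) ^ m)" for m
  define d where "d j = smult (of_nat (full \<Upsilon> (2 * j + 2) k) / fact (k * (2 * j + 2)))
    ((x_poly - 1) ^ j)" for j
  have smult_sum_right: "smult c (\<Sum>j\<in>I. f j) = (\<Sum>j\<in>I. smult c (f j))"
    for c and f :: "nat \<Rightarrow> rat poly" and I
    by (induction I rule: infinite_finite_induct) (simp_all add: smult_add_right)
  have of_nat_mult_smult: "of_nat c * p = smult (of_nat c) p" for c and p :: "rat poly"
    by (simp add: of_nat_poly)
  have rec: "h m = n m + (\<Sum>j<m. d j * h (m - Suc j))" for m
  proof -
    have "smult (1 / fact (k * (2 * m + 1)))
        ((x_poly - 1) ^ j * (of_nat ((k * (2 * m + 1)) choose (k * (2 * j + 2))) *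
          (of_nat (full \<Upsilon> (2 * j + 2) k) * A (m - Suc j)))) = d j * h (m - Suc j)"
      if j: "j < m" for j
    proof -
      have "k * (2 * j + 2) \<le> k * (2 * m + 1)" using j by (intro mult_le_mono2) simp
      moreover have "k * (2 * m + 1) - k * (2 * j + 2) = k * (2 * (m - Suc j) + 1)"
      proof -
        obtain l where "m = Suc j + l" using j by (auto simp: less_iff_Suc_add)
        then show ?thesis by (simp add: algebra_simps)
      qed
      ultimately have "of_nat ((k * (2 * m + 1)) choose (k * (2 * j + 2))) =
          (fact (k * (2 * m + 1)) / (fact (k * (2 * j + 2)) * fact (k * (2 * (m - Suc j) + 1))) :: rat)"
        by (simp only: binomial_fact)
      then show ?thesis
        unfolding d_def h_def of_nat_mult_smult by (simp add: mult.commute)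
    qed
    note summand = this
    have A_rec: "A m = (x_poly - 1) ^ m * of_nat (full \<Upsilon> (2 * m + 1) k) +
        (\<Sum>j<m. (x_poly - 1) ^ j * (of_nat ((k * (2 * m + 1)) choose (k * (2 * j + 2))) *
          (of_nat (full \<Upsilon> (2 * j + 2) k) * A (m - Suc j))))"
      unfolding A_def by (rule sum_weight_recurrence)
    have "h m = smult (1 / fact (k * (2 * m + 1)))
        (of_nat (full \<Upsilon> (2 * m + 1) k) * (x_poly - 1) ^ m) + (\<Sum>j<m. d j * h (m - Suc j))"
      unfolding h_def[of m] A_rec smult_add_right smult_sum_right
      by (intro arg_cong2[where f = "(+)"] sum.cong)
        (simp_all only: summand lessThan_iff mult.commute[of "of_nat (full \<Upsilon> (2 * m + 1) k)"])
    then show ?thesis unfolding n_def of_nat_mult_smult by simp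
  qed
  have ix: "2 * Suc m = 2 * m + 2" "2 * m + 2 - 1 = 2 * m + 1" "Suc m - 1 = m"
    "2 * k * Suc m = k * (2 * m + 2)" for m
    by simp_all
  show ?thesis
    unfolding infsum_odd_monomials infsum_even_monomials ix sum_fillings2
    unfolding A_def[symmetric] h_def[symmetric] n_def[symmetric] d_def[symmetric]
    by (rule sym, subst fps_quot_eq_iff) (simp, rule fps_odd_recurrence[OF rec])
qed

end
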